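(* Let $0<\phi<1$, $0<\alpha_-<1$, $0<\delta_-\le1$. For an integer $m\ge1$, a number $s$ with $\phi(1-\phi^{m-1})/(1-\phi)\le s<\phi(1-\phi^m)/(1-\phi)$, and integers $0\le j\le m-1$, $k\ge m$, let $$R_m(j,k)=\big((j+1)^{\alpha_-}-1\big)+\big((k+1)^{\alpha_-}-(j+1)^{\alpha_-}\big)\Big(\frac{s(1-\phi)-\phi(1-\phi^j)}{\phi^{j+1}(1-\phi^{k-j})}\Big)^{\delta_-}.$$ Below, minimization of $R_m(j,k)$ is over integers $k\ge m$, with $m,j$ (and $s$) fixed. Put $\kappa=\delta_-(1-\alpha_-)/(-\log\phi)$. (i) Suppose $\alpha_-\ge\delta_-$. Then for every $m\ge1$ and $j\in[0,m-1]\cap\mathbb{Z}$, $R_m(j,k)$ is minimized at $k=m$. (ii) Suppose $\alpha_-<\delta_-$. (a) If $\phi\le e^{-\delta_-(1-\alpha_-)}$, then for every $m\ge1$ and $j\in[0,m-1]\cap\mathbb{Z}$, $R_m(j,k)$ is minimized at $k=m$. (b) If $\phi>e^{-\delta_-(1-\alpha_-)}$, then for every $m\ge\lceil\kappa\rceil$ and $j\in[\kappa-1,m-1]\cap\mathbb{Z}$, $R_m(j,k)$ is minimized at $k=m$. (c) If $\phi>e^{-\delta_-(1-\alpha_-)}$, and either $m\ge\lceil\kappa\rceil$ and $j\in[0,\kappa-1)\cap\mathbb{Z}$, or $m<\lceil\kappa\rceil$ and $j\in[0,m-1]\cap\mathbb{Z}$, define $$g_{m,j}(x)=\frac{\phi^{-x}-1}{-\log\phi}-\frac{\delta_-}{\alpha_-}\Big((j+1+x)-(j+1)^{\alpha_-}(j+1+x)^{1-\alpha_-}\Big).$$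 If there exists $x_0>0$ such that $g_{m,j}(x_0)=0$, $g_{m,j}<0$ immediately to the left of $x_0$ and $g_{m,j}>0$ immediately to the right of $x_0$, then: - if $j+\lfloor x_0\rfloor\ge m+1$, $R_m(j,k)$ is minimized at some $k\in\{m,\ j+\lfloor x_0\rfloor,\ j+\lfloor x_0\rfloor+1\}$; - if $j+\lfloor x_0\rfloor=m$, $R_m(j,k)$ is minimized at some $k\in\{m,m+1\}$; - if $j+\lfloor x_0\rfloor\le m-1$, $R_m(j,k)$ is minimized at $k=m$. If no such $x_0$ exists, then $R_m(j,k)$ is minimized at $k=m$.
   Context: "$R_m(j,k)$ is minimized at $k=k_0$" means $R_m(j,k_0)\le R_m(j,k)$ for all integers $k\ge m$. "Immediately to the left (right) of $x_0$" means on $(x_0-\varepsilon,x_0)$ (respectively $(x_0,x_0+\varepsilon)$) for some $\varepsilon>0$. *)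

theory Defs
  imports Complex_Main
begin

(* R_m(j,k) depends on m only through the admissible range of s and the ranges of j and k, so m is
   not an argument.  In use j < m \<le> k, hence k - j is a genuine subtraction.  The base of the
   last power is nonnegative and may be 0 (for j = m - 1 and s at the left end of its range);
   as delta > 0, the convention 0 powr delta = 0 gives the intended value. *)
definition R :: "real \<Rightarrow> real \<Rightarrow> real \<Rightarrow> real \<Rightarrow> nat \<Rightarrow> nat \<Rightarrow> real" where
  "R \<phi> \<alpha> \<delta> s j k =
     ((real j + 1) powr \<alpha> - 1)
     + ((real k + 1) powr \<alpha> - (real j + 1) powr \<alpha>)
       * ((s * (1 - \<phi>) - \<phi> * (1 - \<phi> ^ j)) / (\<phi> ^ (j + 1) * (1 - \<phi> ^ (k - j)))) powr \<delta>"

definition minimized_at :: "nat \<Rightarrow> (nat \<Rightarrow> real) \<Rightarrow> nat \<Rightarrow> bool" where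
  "minimized_at m F k0 \<longleftrightarrow> m \<le> k0 \<and> (\<forall>k\<ge>m. F k0 \<le> F k)"

definition kappa :: "real \<Rightarrow> real \<Rightarrow> real \<Rightarrow> real" where
  "kappa \<phi> \<alpha> \<delta> = \<delta> * (1 - \<alpha>) / (- ln \<phi>)"

definition g :: "real \<Rightarrow> real \<Rightarrow> real \<Rightarrow> nat \<Rightarrow> real \<Rightarrow> real" where
  "g \<phi> \<alpha> \<delta> j x =
     (\<phi> powr (- x) - 1) / (- ln \<phi>)
     - \<delta> / \<alpha> * ((real j + 1 + x) - (real j + 1) powr \<alpha> * (real j + 1 + x) powr (1 - \<alpha>))"

definition upcrossing :: "(real \<Rightarrow> real) \<Rightarrow> real \<Rightarrow> bool" where
  "upcrossing f x0 \<longleftrightarrow> x0 > 0 \<and> f x0 = 0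
     \<and> (\<exists>\<epsilon>>0. \<forall>x\<in>{x0 - \<epsilon><..<x0}. f x < 0)
     \<and> (\<exists>\<epsilon>>0. \<forall>x\<in>{x0<..<x0 + \<epsilon>}. f x > 0)"

end

theory Submission
  imports Defs
begin

text \<open>Put \<open>c = j + 1\<close>. Up to an affine change with nonnegative slope, \<open>R j k\<close> is the function
  \<open>h x = ((c + x) powr \<alpha> - c powr \<alpha>) * (1 - \<phi> powr x) powr - \<delta>\<close> at \<open>x = k - j\<close>, and \<open>h' x\<close> is
  \<open>g x\<close> times a positive factor. As \<open>g 0 = 0\<close> and \<open>g''\<close> is increasing, the mean value theorem
  shows that once \<open>g\<close> has been negative and has returned to a nonnegative value, it remains positive.
  Hence \<open>g\<close> has the sign pattern \<open>+\<close>, or \<open>+ - +\<close> with a unique upcrossing (where the first \<open>+\<close> may be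
  missing), and \<open>h\<close> is increasing, or increasing, decreasing and increasing again. In (i), (ii)(a)
  and (ii)(b), \<open>g' \<ge> 0\<close>, so only the first pattern occurs.\<close>

section \<open>Sign changes under an increasing second derivative, and reduction to finitely many
  candidates\<close>

lemma pos_after_return:
  fixes f f' f'' :: "real \<Rightarrow> real"
  assumes f: "\<And>x. 0 \<le> x \<Longrightarrow> (f has_real_derivative f' x) (at x)"
    and f': "\<And>x. 0 \<le> x \<Longrightarrow> (f' has_real_derivative f'' x) (at x)"
    and mono: "mono_on {0..} f''"
    and "f 0 = 0" "0 < x" "x < y" "y < z" "f x < 0" "0 \<le> f y"
  shows "0 < f z"
proof (rule ccontr)
  \<comment> \<open>With \<open>f z \<le> 0\<close>, the increments of \<open>f\<close> over
    \<open>[0, x]\<close>, \<open>[x, y]\<close> and \<open>[y, z]\<close> are negative, positive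
    and nonpositive. The mean value theorem passes these signs to \<open>f'\<close> at
    \<open>u1 < u2 < u3\<close>, and then gives \<open>f''\<close> a positive value followed by a
    negative one.\<close>
  assume "\<not> 0 < f z"
  obtain u1 where u1: "0 < u1" "u1 < x" "f x - f 0 = (x - 0) * f' u1"
    using MVT2[of 0 x f f'] f \<open>0 < x\<close> by auto
  obtain u2 where u2: "x < u2" "u2 < y" "f y - f x = (y - x) * f' u2"
    using MVT2[of x y f f'] f \<open>0 < x\<close> \<open>x < y\<close> by auto
  obtain u3 where u3: "y < u3" "u3 < z" "f z - f y = (z - y) * f' u3"
    using MVT2[of y z f f'] f \<open>0 < x\<close> \<open>x < y\<close> \<open>y < z\<close> by auto
  have "x * f' u1 < 0" using u1 assms by simp
  hence 1: "f' u1 < 0" using \<open>0 < x\<close> by (simp add: mult_less_0_iff)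
  have "(y - x) * f' u2 > 0" using u2 assms by simp
  hence 2: "f' u2 > 0" using \<open>x < y\<close> by (simp add: zero_less_mult_iff)
  have "(z - y) * f' u3 \<le> 0" using u3 assms \<open>\<not> 0 < f z\<close> by simp
  hence 3: "f' u3 \<le> 0" using \<open>y < z\<close> by (simp add: mult_le_0_iff)
  obtain v1 where v1: "u1 < v1" "v1 < u2" "f' u2 - f' u1 = (u2 - u1) * f'' v1"
    using MVT2[of u1 u2 f' f''] f' u1 u2 by auto
  obtain v2 where v2: "u2 < v2" "v2 < u3" "f' u3 - f' u2 = (u3 - u2) * f'' v2"
    using MVT2[of u2 u3 f' f''] f' u1 u2 u3 by auto
  have "(u2 - u1) * f'' v1 > 0" using v1 1 2 by simp
  hence "f'' v1 > 0" using u1 u2 by (simp add: zero_less_mult_iff)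
  moreover have "(u3 - u2) * f'' v2 < 0" using v2 2 3 by simp
  hence "f'' v2 < 0" using u2 u3 by (simp add: mult_less_0_iff)
  moreover have "f'' v1 \<le> f'' v2"
    using v1 v2 u1 by (intro mono_onD[OF mono]) auto
  ultimately show False by simp
qed

lemma minimized_at_finite_candidates:
  assumes "finite A" "A \<noteq> {}" "\<And>a. a \<in> A \<Longrightarrow> m \<le> a"
    and "\<And>k. m \<le> k \<Longrightarrow> \<exists>a\<in>A. F a \<le> F k"
  shows "\<exists>a\<in>A. minimized_at m F a"
proof -
  obtain a where "a \<in> A" "\<forall>b\<in>A. F a \<le> F b"
    using arg_min_if_finite[OF assms(1,2), of F] by (meson not_le)
  with assms(3,4) show ?thesis unfolding minimized_at_def by (meson order_trans)
qed

section \<open>The functions \<open>g\<close> and \<open>h\<close> for fixed \<open>j\<close>, and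
  the derivatives of \<open>g\<close>\<close>

locale parameters =
  fixes \<phi> \<alpha> \<delta> :: real and j :: nat
  assumes phi: "0 < \<phi>" "\<phi> < 1" and alpha: "0 < \<alpha>" "\<alpha> < 1" and delta: "0 < \<delta>" "\<delta> \<le> 1"
begin

definition c :: real where "c = real j + 1"

definition g' :: "real \<Rightarrow> real" where
  "g' x = \<phi> powr (- x) - \<delta> / \<alpha> * (1 - (1 - \<alpha>) * (c powr \<alpha> * (c + x) powr (- \<alpha>)))"

definition g'' :: "real \<Rightarrow> real" where
  "g'' x = - ln \<phi> * \<phi> powr (- x) - \<delta> * (1 - \<alpha>) * (c powr \<alpha> * (c + x) powr (- \<alpha> - 1))"

definition h :: "real \<Rightarrow> real" where
  "h x = ((c + x) powr \<alpha> - c powr \<alpha>) * (1 - \<phi> powr x) powr (- \<delta>)"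

lemma c_pos: "0 < c"
  by (simp add: c_def)

lemma ln_phi_neg: "ln \<phi> < 0"
  using phi by simp

lemma g_eq:
  "g \<phi> \<alpha> \<delta> j x =
    (\<phi> powr (- x) - 1) / (- ln \<phi>) - \<delta> / \<alpha> * ((c + x) - c powr \<alpha> * (c + x) powr (1 - \<alpha>))"
  by (simp add: g_def c_def)

lemma g_0: "g \<phi> \<alpha> \<delta> j 0 = 0"
  using phi c_pos by (simp add: g_eq flip: powr_add)

lemma DERIV_phi_powr: "((\<lambda>x. \<phi> powr (- x)) has_real_derivative \<phi> powr (- x) * - ln \<phi>) (at x)"
  using phi by (auto intro!: derivative_eq_intros)

lemma DERIV_shifted_powr:
  assumes "0 \<le> x"
  shows "((\<lambda>x. (c + x) powr r) has_real_derivative r * (c + x) powr (r - 1)) (at x)"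
  using assms c_pos by (auto intro!: derivative_eq_intros)

lemma DERIV_g:
  assumes "0 \<le> x"
  shows "(g \<phi> \<alpha> \<delta> j has_real_derivative g' x) (at x)"
  unfolding g_eq[abs_def] g'_def using ln_phi_neg
  by (intro DERIV_cong[OF DERIV_diff[OF
        DERIV_cdivide[OF DERIV_diff[OF DERIV_phi_powr DERIV_const]]
        DERIV_cmult[OF DERIV_diff[OF DERIV_add[OF DERIV_const DERIV_ident]
          DERIV_cmult[OF DERIV_shifted_powr[OF assms]]]]]])
    (simp add: algebra_simps)

lemma DERIV_g':
  assumes "0 \<le> x"
  shows "(g' has_real_derivative g'' x) (at x)"
  unfolding g'_def[abs_def] g''_def using alpha
  by (intro DERIV_cong[OF DERIV_diff[OF DERIV_phi_powr
        DERIV_cmult[OF DERIV_diff[OF DERIV_const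
          DERIV_cmult[OF DERIV_cmult[OF DERIV_shifted_powr[OF assms]]]]]]])
    (simp add: field_simps)

lemma mono_g'': "mono_on {0..} g''"
proof (rule mono_onI)
  fix x y :: real assume xy: "x \<in> {0..}" "y \<in> {0..}" "x \<le> y"
  have "\<phi> powr (- x) \<le> \<phi> powr (- y)"
    using phi xy by (intro powr_mono') auto
  hence "- ln \<phi> * \<phi> powr (- x) \<le> - ln \<phi> * \<phi> powr (- y)"
    using ln_phi_neg by (intro mult_left_mono) auto
  moreover have "(c + y) powr (- \<alpha> - 1) \<le> (c + x) powr (- \<alpha> - 1)"
    using xy alpha c_pos by (intro powr_mono2') auto
  hence "\<delta> * (1 - \<alpha>) * (c powr \<alpha> * (c + y) powr (- \<alpha> - 1))
      \<le> \<delta> * (1 - \<alpha>) * (c powr \<alpha> * (c + x) powr (- \<alpha> - 1))"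
    using alpha delta by (intro mult_left_mono) auto
  ultimately show "g'' x \<le> g'' y" by (simp add: g''_def)
qed

section \<open>Sign pattern of \<open>g\<close> on the nonnegative axis\<close>

lemmas g_pos_after_return = pos_after_return[OF DERIV_g DERIV_g' mono_g'' g_0]

lemma g_nonneg_if_g'_nonneg:
  assumes "\<And>t. 0 \<le> t \<Longrightarrow> 0 \<le> g' t" "0 \<le> x"
  shows "0 \<le> g \<phi> \<alpha> \<delta> j x"
proof -
  have "g \<phi> \<alpha> \<delta> j 0 \<le> g \<phi> \<alpha> \<delta> j x"
    using assms by (intro DERIV_nonneg_imp_nondecreasing[OF \<open>0 \<le> x\<close>]) (auto intro!: DERIV_g exI)
  thus ?thesis by (simp add: g_0)
qed

text \<open>The exponential term of \<open>g'\<close> is at least 1, while the subtracted term is at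
  most \<open>\<delta> / \<alpha>\<close>, hence at most 1.\<close>

lemma g'_nonneg_of_delta_le_alpha:
  assumes "\<delta> \<le> \<alpha>" "0 \<le> x"
  shows "0 \<le> g' x"
proof -
  have "\<phi> powr 0 \<le> \<phi> powr (- x)"
    using phi assms by (intro powr_mono') auto
  moreover have "\<delta> / \<alpha> * (1 - (1 - \<alpha>) * (c powr \<alpha> * (c + x) powr (- \<alpha>))) \<le> \<delta> / \<alpha>"
    using alpha delta by (intro mult_left_le) auto
  moreover have "\<delta> / \<alpha> \<le> 1" using assms alpha by simp
  ultimately show ?thesis using phi by (simp add: g'_def)
qed

text \<open>The bound \<open>kappa \<le> c\<close> amounts to \<open>g'' 0 \<ge> 0\<close>. As
  \<open>g''\<close> increases, \<open>g'\<close> then increases from its initial value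
  \<open>1 - \<delta>\<close>, which is nonnegative.\<close>

lemma g'_nonneg_of_kappa_le:
  assumes "kappa \<phi> \<alpha> \<delta> - 1 \<le> real j" "0 \<le> x"
  shows "0 \<le> g' x"
proof -
  have "\<delta> * (1 - \<alpha>) / (- ln \<phi>) \<le> c"
    using assms by (simp add: kappa_def c_def)
  hence "\<delta> * (1 - \<alpha>) / c \<le> - ln \<phi>"
    using ln_phi_neg c_pos by (simp add: field_simps)
  moreover have "g'' 0 = - ln \<phi> - \<delta> * (1 - \<alpha>) * (c powr \<alpha> * c powr (- \<alpha> - 1))"
    using phi by (simp add: g''_def)
  moreover have "c powr \<alpha> * c powr (- \<alpha> - 1) = 1 / c"
    using c_pos powr_neg_one[of c] by (simp flip: powr_add)
  ultimately have "0 \<le> g'' 0" by simp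
  moreover have "g'' 0 \<le> g'' t" if "0 \<le> t" for t
    using mono_onD[OF mono_g''] that by simp
  ultimately have "g' 0 \<le> g' x"
    using assms(2) by (intro DERIV_nonneg_imp_nondecreasing[OF assms(2)])
      (auto intro!: DERIV_g' exI intro: order_trans)
  moreover have "g' 0 = 1 - \<delta>"
    using phi alpha c_pos by (simp add: g'_def flip: powr_add)
  ultimately show ?thesis using delta by simp
qed

lemma g_eventually_pos: "\<exists>y>x. 0 < g \<phi> \<alpha> \<delta> j y"
proof -
  define L where "L = - ln \<phi>"
  have L: "0 < L" using ln_phi_neg by (simp add: L_def)
  \<comment> \<open>The exponential part of \<open>g\<close> at \<open>y\<close> is at least
    \<open>L * y\<^sup>2 / 2\<close>. Having \<open>y \<ge> c\<close> bounds the subtracted part by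
    \<open>\<delta> / \<alpha> * (2 * y)\<close>, and
    \<open>y > 4 * \<delta> / (\<alpha> * L)\<close> is exactly when the quadratic exceeds
    this.\<close>
  define y where "y = c + \<bar>x\<bar> + 4 * \<delta> / (\<alpha> * L) + 1"
  have pos: "0 < 4 * \<delta> / (\<alpha> * L)" using alpha delta L by simp
  have y: "x < y" "c \<le> y" "0 < y" "4 * \<delta> / (\<alpha> * L) < y"
    unfolding y_def using pos c_pos by linarith+
  have "1 + L * y + (L * y)\<^sup>2 / 2 \<le> exp (L * y)"
    using L y by (intro exp_lower_Taylor_quadratic) simp
  also have "exp (L * y) = \<phi> powr (- y)"
    using phi by (simp add: powr_def L_def)
  finally have "L * (L * y\<^sup>2 / 2) \<le> \<phi> powr (- y) - 1"
    using mult_pos_pos[OF L \<open>0 < y\<close>] by (simp add: power2_eq_square algebra_simps)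
  hence 1: "L * y\<^sup>2 / 2 \<le> (\<phi> powr (- y) - 1) / L"
    using L by (simp add: pos_le_divide_eq mult.commute)
  have "0 \<le> c powr \<alpha> * (c + y) powr (1 - \<alpha>)" by simp
  hence "c + y - c powr \<alpha> * (c + y) powr (1 - \<alpha>) \<le> 2 * y"
    using \<open>c \<le> y\<close> by linarith
  hence "\<delta> / \<alpha> * ((c + y) - c powr \<alpha> * (c + y) powr (1 - \<alpha>)) \<le> \<delta> / \<alpha> * (2 * y)"
    using alpha delta by (intro mult_left_mono) auto
  also have "\<dots> < L * y\<^sup>2 / 2"
  proof -
    have "4 * \<delta> < y * (\<alpha> * L)"
      using y(4) alpha L by (simp add: pos_divide_less_eq)
    hence "4 * \<delta> * y < y * (\<alpha> * L) * y" using y by (intro mult_strict_right_mono)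
    thus ?thesis using alpha by (simp add: field_simps power2_eq_square)
  qed
  finally have "0 < g \<phi> \<alpha> \<delta> j y"
    using 1 unfolding g_eq L_def[symmetric] by linarith
  with \<open>x < y\<close> show ?thesis by blast
qed

text \<open>A negative value would be followed by a zero \<open>x0\<close>, because \<open>g\<close>
  is positive somewhere further on. An earlier return to a nonnegative value would make
  \<open>g\<close> positive at \<open>x0\<close>, so \<open>g\<close> is negative up to
  \<open>x0\<close>; beyond it \<open>g\<close> is positive, and \<open>x0\<close> is an
  upcrossing.\<close>

lemma g_nonneg_if_no_upcrossing:
  assumes "\<nexists>x0. upcrossing (g \<phi> \<alpha> \<delta> j) x0" "0 \<le> x"
  shows "0 \<le> g \<phi> \<alpha> \<delta> j x"
proof (rule ccontr)
  assume neg: "\<not> 0 \<le> g \<phi> \<alpha> \<delta> j x"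
  hence "0 < x" using assms(2) g_0 by (cases "x = 0") auto
  obtain y where y: "x < y" "0 < g \<phi> \<alpha> \<delta> j y" using g_eventually_pos by blast
  have "\<exists>t\<ge>x. t \<le> y \<and> g \<phi> \<alpha> \<delta> j t = 0"
    using y neg assms(2) by (intro IVT) (auto intro!: DERIV_isCont DERIV_g)
  then obtain x0 where x0: "x \<le> x0" "g \<phi> \<alpha> \<delta> j x0 = 0" by blast
  have "x < x0" using x0 neg by (cases "x = x0") auto
  have "g \<phi> \<alpha> \<delta> j t < 0" if "x < t" "t < x0" for t
    using g_pos_after_return[of x t x0] that neg \<open>0 < x\<close> x0 by force
  moreover have "0 < g \<phi> \<alpha> \<delta> j t" if "x0 < t" for t
    using g_pos_after_return[of x x0 t] that neg \<open>0 < x\<close> \<open>x < x0\<close> x0 by force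
  ultimately have "upcrossing (g \<phi> \<alpha> \<delta> j) x0"
    unfolding upcrossing_def using x0 \<open>0 < x\<close> \<open>x < x0\<close>
    by (intro conjI exI[of _ "x0 - x"] exI[of _ "1::real"]) auto
  with assms(1) show False by blast
qed

lemma g_pos_after_upcrossing:
  assumes "upcrossing (g \<phi> \<alpha> \<delta> j) x0" "x0 < x"
  shows "0 < g \<phi> \<alpha> \<delta> j x"
proof -
  obtain e where x0: "0 < x0" "g \<phi> \<alpha> \<delta> j x0 = 0" "0 < e"
      and e: "\<forall>t\<in>{x0 - e<..<x0}. g \<phi> \<alpha> \<delta> j t < 0"
    using assms(1) by (auto simp: upcrossing_def)
  \<comment> \<open>The maximum with 0 keeps \<open>t\<close> positive, as the return argument
    requires, even if \<open>x0 - e\<close> is negative.\<close>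
  obtain t where t: "max 0 (x0 - e) < t" "t < x0"
    using dense[of "max 0 (x0 - e)" x0] x0 by auto
  show ?thesis
    using g_pos_after_return[of t x0 x] e t x0 assms(2) by auto
qed

text \<open>A nonnegative value at \<open>t\<close> would be a return before \<open>x0\<close> and
  would force \<open>g\<close> to be positive at \<open>x0\<close>, where it vanishes.\<close>

lemma g_neg_until_upcrossing:
  assumes "upcrossing (g \<phi> \<alpha> \<delta> j) x0" "0 < x" "g \<phi> \<alpha> \<delta> j x < 0" "x < t" "t < x0"
  shows "g \<phi> \<alpha> \<delta> j t < 0"
  using g_pos_after_return[of x t x0] assms by (force simp: upcrossing_def)

section \<open>Monotonicity of \<open>h\<close> from the sign of \<open>g\<close>\<close>

lemma DERIV_h:
  assumes "0 < x"
  shows "(h has_real_derivative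
    \<alpha> * (- ln \<phi>) * \<phi> powr x * (c + x) powr (\<alpha> - 1) * (1 - \<phi> powr x) powr (- \<delta> - 1)
      * g \<phi> \<alpha> \<delta> j x) (at x)"
proof -
  define u where "u = 1 - \<phi> powr x"
  define w where "w = c + x"
  have w: "0 < w" using assms c_pos by (simp add: w_def)
  have "\<phi> powr x < 1"
    using phi assms by (simp add: powr_def mult_less_0_iff)
  hence u: "0 < u" by (simp add: u_def)
  have "(h has_real_derivative
      \<alpha> * w powr (\<alpha> - 1) * u powr (- \<delta>)
        + (w powr \<alpha> - c powr \<alpha>) * (- \<delta> * u powr (- \<delta> - 1) * (- (\<phi> powr x * ln \<phi>)))) (at x)"
    unfolding h_def[abs_def] using u w phi unfolding u_def w_def
    by (auto intro!: derivative_eq_intros)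
  \<comment> \<open>The factorization explains the shape of \<open>g\<close>. After division by the
    positive factor, the first summand becomes \<open>u / (- ln \<phi> * \<phi> powr x)\<close>, the
    exponential quotient in \<open>g\<close>, and
    \<open>(w powr \<alpha> - c powr \<alpha>) * w powr (1 - \<alpha>)\<close> gives the bracket
    \<open>w - c powr \<alpha> * w powr (1 - \<alpha>)\<close>.\<close>
  moreover have "\<alpha> * w powr (\<alpha> - 1) * u powr (- \<delta>)
      + (w powr \<alpha> - c powr \<alpha>) * (- \<delta> * u powr (- \<delta> - 1) * (- (\<phi> powr x * ln \<phi>)))
    = \<alpha> * (- ln \<phi>) * \<phi> powr x * w powr (\<alpha> - 1) * u powr (- \<delta> - 1) * g \<phi> \<alpha> \<delta> j x"
    (is "_ = ?rhs")
  proof -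
    define q where "q = (\<phi> powr (- x) - 1) / (- ln \<phi>)"
    have "w powr (\<alpha> - 1) * w powr (1 - \<alpha>) = 1" "w powr (\<alpha> - 1) * w = w powr \<alpha>"
      using w by (simp_all flip: powr_add add: powr_diff)
    hence g: "w powr (\<alpha> - 1) * g \<phi> \<alpha> \<delta> j x
        = w powr (\<alpha> - 1) * q - \<delta> / \<alpha> * (w powr \<alpha> - c powr \<alpha>)"
      unfolding g_eq w_def[symmetric] q_def by (simp add: algebra_simps)
    have "\<phi> powr x * (\<phi> powr (- x) - 1) = u"
      using phi by (simp add: u_def algebra_simps flip: powr_add)
    hence q: "- ln \<phi> * \<phi> powr x * q = u"
      using ln_phi_neg by (simp add: q_def)
    have "?rhs = \<alpha> * (- ln \<phi>) * \<phi> powr x * u powr (- \<delta> - 1) * (w powr (\<alpha> - 1) * g \<phi> \<alpha> \<delta> j x)"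
      by (simp add: mult_ac)
    also have "\<dots> = \<alpha> * w powr (\<alpha> - 1) * (u powr (- \<delta> - 1) * (- ln \<phi> * \<phi> powr x * q))
        + (w powr \<alpha> - c powr \<alpha>) * (- \<delta> * u powr (- \<delta> - 1) * (- (\<phi> powr x * ln \<phi>)))"
      unfolding g using alpha by (simp add: field_simps)
    also have "u powr (- \<delta> - 1) * (- ln \<phi> * \<phi> powr x * q) = u powr (- \<delta>)"
      unfolding q using u by (simp add: powr_diff)
    finally show ?thesis ..
  qed
  ultimately show ?thesis by (simp add: u_def w_def)
qed

lemma h_mono:
  assumes "0 < x" "x \<le> y" "\<And>t. x < t \<Longrightarrow> t < y \<Longrightarrow> 0 \<le> g \<phi> \<alpha> \<delta> j t"
  shows "h x \<le> h y"
proof (rule DERIV_nonneg_imp_increasing_open[OF assms(2)])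
  show "continuous_on {x..y} h"
    using assms by (intro continuous_at_imp_continuous_on ballI DERIV_isCont[OF DERIV_h]) auto
  fix t assume "x < t" "t < y"
  thus "\<exists>d. (h has_real_derivative d) (at t) \<and> 0 \<le> d"
    using assms alpha ln_phi_neg
    by (intro exI conjI) (rule DERIV_h, simp, intro mult_nonneg_nonneg, auto)
qed

lemma h_antimono:
  assumes "0 < x" "x \<le> y" "\<And>t. x < t \<Longrightarrow> t < y \<Longrightarrow> g \<phi> \<alpha> \<delta> j t \<le> 0"
  shows "h y \<le> h x"
proof (rule DERIV_nonpos_imp_decreasing_open[OF assms(2)])
  show "continuous_on {x..y} h"
    using assms by (intro continuous_at_imp_continuous_on ballI DERIV_isCont[OF DERIV_h]) auto
  fix t assume "x < t" "t < y"
  thus "\<exists>d. (h has_real_derivative d) (at t) \<and> d \<le> 0"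
    using assms alpha ln_phi_neg
    by (intro exI conjI) (rule DERIV_h, simp, intro mult_nonneg_nonpos mult_nonneg_nonneg, auto)
qed

section \<open>Transfer from \<open>h\<close> to \<open>R\<close> and location of the
  minimum\<close>

text \<open>The base of the last power in \<open>R\<close> may be split whatever its sign, because \<open>powr\<close> of a
  negative base is the \<open>powr\<close> of its absolute value.\<close>

lemma R_eq_h:
  assumes "j < k"
  shows "R \<phi> \<alpha> \<delta> s j k =
    (c powr \<alpha> - 1) + ((s * (1 - \<phi>) - \<phi> * (1 - \<phi> ^ j)) / \<phi> ^ (j + 1)) powr \<delta> * h (real k - real j)"
proof -
  have "((s * (1 - \<phi>) - \<phi> * (1 - \<phi> ^ j)) / \<phi> ^ (j + 1) / (1 - \<phi> ^ (k - j))) powr \<delta>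
    = ((s * (1 - \<phi>) - \<phi> * (1 - \<phi> ^ j)) / \<phi> ^ (j + 1)) powr \<delta> / (1 - \<phi> ^ (k - j)) powr \<delta>"
    by (rule powr_divide)
  moreover have "\<phi> ^ (k - j) = \<phi> powr (real k - real j)"
    using phi assms by (simp flip: powr_realpow add: of_nat_diff)
  ultimately show ?thesis
    by (simp add: R_def h_def c_def powr_minus divide_inverse mult_ac add_ac)
qed

text \<open>The factor multiplying \<open>h\<close> is a value of \<open>powr\<close>, hence
  nonnegative, so the affine change preserves the order.\<close>

lemma R_le_if_h_le:
  assumes "j < k" "j < l"
    and "h (real k - real j) \<le> h (real l - real j)"
  shows "R \<phi> \<alpha> \<delta> s j k \<le> R \<phi> \<alpha> \<delta> s j l"
  using assms by (simp add: R_eq_h mult_left_mono)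

lemma minimized_at_start:
  assumes "j < m"
    and "\<And>t. real m - real j \<le> t \<Longrightarrow> 0 \<le> g \<phi> \<alpha> \<delta> j t"
  shows "minimized_at m (R \<phi> \<alpha> \<delta> s j) m"
  using assms by (auto simp: minimized_at_def intro!: R_le_if_h_le h_mono)

lemma h_after_upcrossing_mono:
  assumes "upcrossing (g \<phi> \<alpha> \<delta> j) x0" "x0 \<le> x" "x \<le> y"
  shows "h x \<le> h y"
  using assms g_pos_after_upcrossing[OF assms(1)]
  by (intro h_mono) (auto simp: upcrossing_def intro: less_imp_le)

text \<open>Up to an upcrossing, \<open>h\<close> increases and then decreases, so on an interval
  there it is smallest at an endpoint. If \<open>g\<close> has been negative somewhere up to
  \<open>x\<close>, it stays negative until \<open>x0\<close> and \<open>h\<close> decreases from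
  \<open>x\<close> to \<open>b\<close>; otherwise \<open>h\<close> increases from \<open>a\<close>
  to \<open>x\<close>.\<close>

lemma h_min_endpoints:
  assumes x0: "upcrossing (g \<phi> \<alpha> \<delta> j) x0" and "0 < a" "a \<le> x" "x \<le> b" "b \<le> x0"
  shows "h a \<le> h x \<or> h b \<le> h x"
proof (cases "\<exists>t\<in>{0<..x}. g \<phi> \<alpha> \<delta> j t < 0")
  case True
  then obtain t where "0 < t" "t \<le> x" "g \<phi> \<alpha> \<delta> j t < 0" by auto
  hence "h b \<le> h x"
    using g_neg_until_upcrossing[OF x0, of t] assms
    by (intro h_antimono) (auto intro: less_imp_le)
  thus ?thesis ..
next
  case False
  hence "h a \<le> h x"
    using assms by (intro h_mono) (auto simp: not_less)
  thus ?thesis ..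
qed

text \<open>\<open>M\<close> is the last integer with \<open>M - j \<le> x0\<close>. Integers from
  \<open>m\<close> to \<open>M\<close> are governed by the endpoints of that range, and those beyond
  \<open>M\<close> by \<open>M + 1\<close>, since \<open>h\<close> increases after
  \<open>x0\<close>. If \<open>M < m\<close>, all admissible \<open>k\<close> lie beyond the
  upcrossing.\<close>

lemma minimized_at_upcrossing:
  assumes "j < m"
    and x0: "upcrossing (g \<phi> \<alpha> \<delta> j) x0" and "M = j + nat \<lfloor>x0\<rfloor>"
  shows "m \<le> M \<Longrightarrow> \<exists>k\<in>{m, M, M + 1}. minimized_at m (R \<phi> \<alpha> \<delta> s j) k"
    and "M < m \<Longrightarrow> minimized_at m (R \<phi> \<alpha> \<delta> s j) m"
proof -
  \<comment> \<open>Positivity ensures that \<open>nat\<close> does not truncate the floor of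
    \<open>x0\<close>.\<close>
  have "0 < x0" using x0 by (simp add: upcrossing_def)
  hence M: "real M - real j \<le> x0" "x0 < real (M + 1) - real j"
    using \<open>M = _\<close> by (simp_all, linarith)
  show "\<exists>k\<in>{m, M, M + 1}. minimized_at m (R \<phi> \<alpha> \<delta> s j) k" if "m \<le> M"
  proof (rule minimized_at_finite_candidates)
    fix k assume "m \<le> k"
    show "\<exists>a\<in>{m, M, M + 1}. R \<phi> \<alpha> \<delta> s j a \<le> R \<phi> \<alpha> \<delta> s j k"
    proof (cases "k \<le> M")
      case True
      hence "h (real m - real j) \<le> h (real k - real j) \<or> h (real M - real j) \<le> h (real k - real j)"
        using \<open>m \<le> k\<close> \<open>j < m\<close> M by (intro h_min_endpoints[OF x0]) auto
      thus ?thesis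
        using R_le_if_h_le \<open>m \<le> k\<close> \<open>j < m\<close> that by (meson insertI1 insertI2 order.strict_trans2)
    next
      case False
      hence "h (real (M + 1) - real j) \<le> h (real k - real j)"
        using M by (intro h_after_upcrossing_mono[OF x0]) auto
      hence "R \<phi> \<alpha> \<delta> s j (M + 1) \<le> R \<phi> \<alpha> \<delta> s j k"
        using \<open>m \<le> k\<close> \<open>j < m\<close> that by (intro R_le_if_h_le) auto
      thus ?thesis by blast
    qed
  qed (use that in auto)
  show "minimized_at m (R \<phi> \<alpha> \<delta> s j) m" if "M < m"
    using that M \<open>j < m\<close> g_pos_after_upcrossing[OF x0]
    by (intro minimized_at_start) (auto intro!: less_imp_le)
qed

end

section \<open>The parameter cases matched with the sign patterns of \<open>g\<close>\<close>

theorem proposition5p5: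
  fixes \<phi> \<alpha> \<delta> s :: real and m j :: nat
  assumes "0 < \<phi>" "\<phi> < 1" "0 < \<alpha>" "\<alpha> < 1" "0 < \<delta>" "\<delta> \<le> 1"
    and "m \<ge> 1"
    and "\<phi> * (1 - \<phi> ^ (m - 1)) / (1 - \<phi>) \<le> s" "s < \<phi> * (1 - \<phi> ^ m) / (1 - \<phi>)"
    and "j \<le> m - 1"
  shows
    "(\<alpha> \<ge> \<delta> \<longrightarrow> minimized_at m (R \<phi> \<alpha> \<delta> s j) m) \<and>
     (\<alpha> < \<delta> \<longrightarrow>
        (\<phi> \<le> exp (- \<delta> * (1 - \<alpha>)) \<longrightarrow> minimized_at m (R \<phi> \<alpha> \<delta> s j) m) \<and>
        (\<phi> > exp (- \<delta> * (1 - \<alpha>)) \<longrightarrow>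
           int m \<ge> \<lceil>kappa \<phi> \<alpha> \<delta>\<rceil> \<and> kappa \<phi> \<alpha> \<delta> - 1 \<le> real j \<longrightarrow>
           minimized_at m (R \<phi> \<alpha> \<delta> s j) m) \<and>
        (\<phi> > exp (- \<delta> * (1 - \<alpha>)) \<longrightarrow>
           (int m \<ge> \<lceil>kappa \<phi> \<alpha> \<delta>\<rceil> \<and> real j < kappa \<phi> \<alpha> \<delta> - 1) \<or>
           (int m < \<lceil>kappa \<phi> \<alpha> \<delta>\<rceil> \<and> j \<le> m - 1) \<longrightarrow>
           (\<forall>x0. upcrossing (g \<phi> \<alpha> \<delta> j) x0 \<longrightarrow>
              (int j + \<lfloor>x0\<rfloor> \<ge> int m + 1 \<longrightarrow>
                 (\<exists>k\<in>{m, j + nat \<lfloor>x0\<rfloor>, j + nat \<lfloor>x0\<rfloor> + 1}. minimized_at m (R \<phi> \<alpha> \<delta> s j) k)) \<and>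
              (int j + \<lfloor>x0\<rfloor> = int m \<longrightarrow>
                 (\<exists>k\<in>{m, m + 1}. minimized_at m (R \<phi> \<alpha> \<delta> s j) k)) \<and>
              (int j + \<lfloor>x0\<rfloor> \<le> int m - 1 \<longrightarrow> minimized_at m (R \<phi> \<alpha> \<delta> s j) m)) \<and>
           ((\<nexists>x0. upcrossing (g \<phi> \<alpha> \<delta> j) x0) \<longrightarrow> minimized_at m (R \<phi> \<alpha> \<delta> s j) m)))"
proof -
  interpret parameters \<phi> \<alpha> \<delta> j
    using assms by unfold_locales auto
  \<comment> \<open>The strict inequality relies on \<open>m \<ge> 1\<close>, because
    \<open>m - 1\<close> is truncated at 0.\<close>
  have "j < m" using assms by simp
  have start: "minimized_at m (R \<phi> \<alpha> \<delta> s j) m" if "\<And>t. 0 \<le> t \<Longrightarrow> 0 \<le> g \<phi> \<alpha> \<delta> j t"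
    using that \<open>j < m\<close> by (intro minimized_at_start) auto
  have i: "minimized_at m (R \<phi> \<alpha> \<delta> s j) m" if "\<delta> \<le> \<alpha>"
    using that by (intro start g_nonneg_if_g'_nonneg g'_nonneg_of_delta_le_alpha)
  have b: "minimized_at m (R \<phi> \<alpha> \<delta> s j) m" if "kappa \<phi> \<alpha> \<delta> - 1 \<le> real j"
    using that by (intro start g_nonneg_if_g'_nonneg g'_nonneg_of_kappa_le)
  \<comment> \<open>Taking logarithms turns the threshold on \<open>\<phi>\<close> into
    \<open>kappa \<le> 1\<close>, so \<open>kappa - 1 \<le> j\<close> holds for every natural
    \<open>j\<close> and the preceding case applies.\<close>
  have a: "minimized_at m (R \<phi> \<alpha> \<delta> s j) m" if "\<phi> \<le> exp (- \<delta> * (1 - \<alpha>))"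
  proof (rule b)
    have "\<delta> * (1 - \<alpha>) \<le> - ln \<phi>"
      using that phi ln_le_cancel_iff[of \<phi> "exp (- \<delta> * (1 - \<alpha>))"] by simp
    hence "kappa \<phi> \<alpha> \<delta> \<le> 1"
      unfolding kappa_def using ln_phi_neg by (subst divide_le_eq_1_pos) simp_all
    thus "kappa \<phi> \<alpha> \<delta> - 1 \<le> real j" by simp
  qed
  have c1: "\<exists>k\<in>{m, j + nat \<lfloor>x0\<rfloor>, j + nat \<lfloor>x0\<rfloor> + 1}. minimized_at m (R \<phi> \<alpha> \<delta> s j) k"
    if "upcrossing (g \<phi> \<alpha> \<delta> j) x0" "int j + \<lfloor>x0\<rfloor> \<ge> int m + 1" for x0
    using that by (intro minimized_at_upcrossing(1)[OF \<open>j < m\<close>]) auto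
  have c2: "\<exists>k\<in>{m, m + 1}. minimized_at m (R \<phi> \<alpha> \<delta> s j) k"
    if "upcrossing (g \<phi> \<alpha> \<delta> j) x0" "int j + \<lfloor>x0\<rfloor> = int m" for x0
  proof -
    \<comment> \<open>Here the first two of the three candidates coincide, which leaves
      \<open>m\<close> and \<open>m + 1\<close>.\<close>
    have "m = j + nat \<lfloor>x0\<rfloor>" using that \<open>j < m\<close> by linarith
    thus ?thesis
      using minimized_at_upcrossing(1)[OF \<open>j < m\<close> that(1)] by auto
  qed
  have c3: "minimized_at m (R \<phi> \<alpha> \<delta> s j) m"
    if "upcrossing (g \<phi> \<alpha> \<delta> j) x0" "int j + \<lfloor>x0\<rfloor> \<le> int m - 1" for x0
    using that \<open>j < m\<close>
    by (intro minimized_at_upcrossing(2)[OF \<open>j < m\<close> that(1) refl]) linarith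
  have c4: "minimized_at m (R \<phi> \<alpha> \<delta> s j) m" if "\<nexists>x0. upcrossing (g \<phi> \<alpha> \<delta> j) x0"
    using that by (intro start g_nonneg_if_no_upcrossing)
  show ?thesis
    using i a b c1 c2 c3 c4 by blast
qed

end
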